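(* Let $X$ be a real normed linear space and let $C\subset X$ be a closed convex subset having the strong separation property. Suppose in addition that at least one of the following conditions is satisfied: (A) $X$ is reflexive and $\operatorname{int}\operatorname{bar}(C)\neq\emptyset$; (B) $C$ is locally compact; (C) there exist $r>0$ and a finite-dimensional subspace $Z$ of $X$ such that $C\subset B(0;r)+Z$. Then $\operatorname{bar}(C)=\operatorname{int}\operatorname{bar}(C)\cup\{0\}$, that is, $x^*\in\operatorname{int}\operatorname{bar}(C)$ whenever $x^*\in\operatorname{bar}(C)\setminus\{0\}$.
   Context: The barrier cone of $C$ is $\operatorname{bar}(C)=\{x^*\in X^*: \sup_{c\in C}\langle x^*,c\rangle<+\infty\}$; $\operatorname{int}$ is the interior in the norm topology of $X^*$. $B(0;r)$ is the open ball of radius $r$ around $0$ in $X$. The closed convex set $C$ is called locally compact if there exist $c_0\in C$ and $r>0$ such that $\overline{B(c_0;r)}\cap C$ is compact, where $\overline{B(c_0;r)}$ is the closed ball of radius $r$ around $c_0$. Convex sets $C,D\subset X$ are strongly separated if there exists $x^*\in X^*\setminus\{0\}$ with $\sup_{c\in C}\langle x^*,c\rangle<\inf_{d\in D}\langle x^*,d\rangle$. A convex set $C$ has the strong separation property if it is strongly separated from every nonempty closed convex subset $D$ of $X$ disjoint from $C$. *)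

theory Defs
  imports "HOL-Analysis.Analysis"
begin

text \<open>The dual of a real normed space \<open>'a\<close> is the type \<open>'a \<Rightarrow>\<^sub>L real\<close> of bounded linear
  functionals; \<open>interior\<close> on it refers to the topology of the operator (dual) norm.
  Suprema and infima are taken in the extended reals, so that they may be infinite and
  \<open>sup {} = -\<infinity>\<close>.\<close>

definition barrier_cone :: "'a::real_normed_vector set \<Rightarrow> ('a \<Rightarrow>\<^sub>L real) set" where
  "barrier_cone C = {f. (SUP c\<in>C. ereal (blinfun_apply f c)) < \<infinity>}"

definition strongly_separated :: "'a::real_normed_vector set \<Rightarrow> 'a set \<Rightarrow> bool" where
  "strongly_separated C D \<longleftrightarrow>
     (\<exists>f :: 'a \<Rightarrow>\<^sub>L real. f \<noteq> 0 \<and>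
        (SUP c\<in>C. ereal (blinfun_apply f c)) < (INF d\<in>D. ereal (blinfun_apply f d)))"

definition strong_separation_property :: "'a::real_normed_vector set \<Rightarrow> bool" where
  "strong_separation_property C \<longleftrightarrow>
     (\<forall>D. D \<noteq> {} \<and> closed D \<and> convex D \<and> C \<inter> D = {} \<longrightarrow> strongly_separated C D)"

text \<open>For closed convex sets, local compactness only asks for one point with a compact
  relative neighbourhood, unlike \<open>locally compact C\<close>.\<close>

definition locally_compact_convex :: "'a::real_normed_vector set \<Rightarrow> bool" where
  "locally_compact_convex C \<longleftrightarrow> (\<exists>c\<^sub>0\<in>C. \<exists>r>0. compact (cball c\<^sub>0 r \<inter> C))"

text \<open>Reflexivity: the canonical embedding into the bidual is onto. The type argument only
  serves to name the space.\<close>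

definition reflexive_space :: "'a::real_normed_vector itself \<Rightarrow> bool" where
  "reflexive_space _ \<longleftrightarrow>
     (\<forall>\<phi> :: ('a \<Rightarrow>\<^sub>L real) \<Rightarrow>\<^sub>L real. \<exists>x::'a. \<forall>f. blinfun_apply \<phi> f = blinfun_apply f x)"

text \<open>Stated through a finite spanning set, since \<open>dim\<close> is \<open>0\<close> on infinite-dimensional
  subspaces.\<close>

definition finite_dim_subspace :: "'a::real_vector set \<Rightarrow> bool" where
  "finite_dim_subspace Z \<longleftrightarrow> subspace Z \<and> (\<exists>B. finite B \<and> Z = span B)"

end

theory Submission
  imports Defs
begin

text \<open>If \<open>f \<noteq> 0\<close> lies in the barrier cone but not in its interior, then \<open>C\<close> contains an unbounded
  sequence along which \<open>f\<close> grows slower than the length. In each of the cases (A), (B), (C) the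
  normalized sequence has a nonzero (weak) limit direction \<open>u\<close>; it is a recession direction of
  \<open>C\<close> with \<open>f u = 0\<close>. The strong separation property forbids this: \<open>f\<close> attains its supremum
  over \<open>C\<close> at some \<open>c\<close> (otherwise a half space would be disjoint from \<open>C\<close> at distance zero), and
  then a closed convex set above the supporting hyperplane, asymptotic to the ray from \<open>c\<close>
  along \<open>u\<close>, is disjoint from \<open>C\<close> at distance zero. In case (A) the weak limit is taken along an
  ultrafilter, \<open>C\<close> is weakly closed because points can be separated from it, and \<open>u \<noteq> 0\<close> follows
  from Baire's theorem in the dual space.\<close>

section \<open>Barrier cones and strong separation through real bounds\<close>

lemma barrier_cone_iff: "f \<in> barrier_cone C \<longleftrightarrow> (\<exists>M. \<forall>c\<in>C. blinfun_apply f c \<le> M)"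
proof
  assume "f \<in> barrier_cone C"
  then have "(SUP c\<in>C. ereal (blinfun_apply f c)) < \<infinity>"
    by (simp add: barrier_cone_def)
  then obtain M where M: "(SUP c\<in>C. ereal (blinfun_apply f c)) < ereal M"
    using ereal_dense2 by blast
  have "blinfun_apply f c \<le> M" if "c \<in> C" for c
  proof -
    have "ereal (blinfun_apply f c) \<le> (SUP c\<in>C. ereal (blinfun_apply f c))"
      using that by (rule SUP_upper)
    also note M
    finally show ?thesis by simp
  qed
  then show "\<exists>M. \<forall>c\<in>C. blinfun_apply f c \<le> M" by blast
next
  assume "\<exists>M. \<forall>c\<in>C. blinfun_apply f c \<le> M"
  then obtain M where "\<forall>c\<in>C. blinfun_apply f c \<le> M" by blast
  then have "(SUP c\<in>C. ereal (blinfun_apply f c)) \<le> ereal M"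
    by (intro SUP_least) simp
  then show "f \<in> barrier_cone C"
    unfolding barrier_cone_def by auto
qed

lemma strongly_separatedE:
  assumes "strongly_separated C D"
  obtains f :: "'a::real_normed_vector \<Rightarrow>\<^sub>L real" and a b where "f \<noteq> 0" "a < b"
    "\<And>c. c \<in> C \<Longrightarrow> blinfun_apply f c \<le> a" "\<And>d. d \<in> D \<Longrightarrow> b \<le> blinfun_apply f d"
proof -
  obtain f :: "'a \<Rightarrow>\<^sub>L real" where f: "f \<noteq> 0"
    "(SUP c\<in>C. ereal (blinfun_apply f c)) < (INF d\<in>D. ereal (blinfun_apply f d))"
    using assms unfolding strongly_separated_def by blast
  obtain a where a: "(SUP c\<in>C. ereal (blinfun_apply f c)) < ereal a"
    "ereal a < (INF d\<in>D. ereal (blinfun_apply f d))"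
    using ereal_dense2[OF f(2)] by blast
  obtain b where b: "ereal a < ereal b" "ereal b < (INF d\<in>D. ereal (blinfun_apply f d))"
    using ereal_dense2[OF a(2)] by blast
  have "blinfun_apply f c \<le> a" if "c \<in> C" for c
    using le_less_trans[OF SUP_upper[OF that] a(1)] by simp
  moreover have "b \<le> blinfun_apply f d" if "d \<in> D" for d
    using less_le_trans[OF b(2) INF_lower[OF that]] by simp
  ultimately show thesis
    using that f(1) b(1) by (meson ereal_less(2) less_ereal.simps(1))
qed

text \<open>A functional is Lipschitz with constant its norm, so a gap \<open>b - a\<close> between
  its values on the two sets keeps them at distance at least
  \<open>(b - a) / norm f\<close>.\<close>

lemma strongly_separated_dist:
  fixes C D :: "'a::real_normed_vector set"
  assumes "strongly_separated C D"
  obtains e where "e > 0" "\<And>c d. c \<in> C \<Longrightarrow> d \<in> D \<Longrightarrow> e \<le> dist c d"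
proof -
  obtain f :: "'a \<Rightarrow>\<^sub>L real" and a b where f: "f \<noteq> 0" "a < b"
    "\<And>c. c \<in> C \<Longrightarrow> blinfun_apply f c \<le> a" "\<And>d. d \<in> D \<Longrightarrow> b \<le> blinfun_apply f d"
    using strongly_separatedE[OF assms] by blast
  have nf: "norm f > 0" using f by simp
  have "(b - a) / norm f \<le> dist c d" if "c \<in> C" "d \<in> D" for c d
  proof -
    have "b - a \<le> blinfun_apply f (d - c)"
      using f(3)[OF that(1)] f(4)[OF that(2)] by (simp add: blinfun.diff_right)
    also have "\<dots> \<le> norm f * norm (d - c)"
      using norm_blinfun[of f "d - c"] by simp
    finally show ?thesis
      using nf by (simp add: dist_norm norm_minus_commute field_simps)
  qed
  then show thesis using that[of "(b - a) / norm f"] f(2) nf by auto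
qed

text \<open>The contrapositive form in which the property is exploited: a closed convex set that
  comes arbitrarily near \<open>C\<close> must meet it. The two main arguments below consist in
  building such a set.\<close>

lemma strong_separation_property_intersects:
  assumes "strong_separation_property C" "D \<noteq> {}" "closed D" "convex D"
    and near: "\<And>e. e > 0 \<Longrightarrow> \<exists>c\<in>C. \<exists>d\<in>D. dist c d < e"
  shows "C \<inter> D \<noteq> {}"
proof
  assume "C \<inter> D = {}"
  then have "strongly_separated C D"
    using assms(1-4) unfolding strong_separation_property_def by blast
  then obtain e where "e > 0" "\<And>c d. c \<in> C \<Longrightarrow> d \<in> D \<Longrightarrow> e \<le> dist c d"
    using strongly_separated_dist by blast
  then show False using near[of e] by (meson not_le)
qed

section \<open>Attained suprema and the exclusion of flat recession directions\<close>

lemma blinfun_real_normalized: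
  fixes f :: "'a::real_normed_vector \<Rightarrow>\<^sub>L real"
  assumes "f \<noteq> 0"
  obtains w where "blinfun_apply f w = 1"
proof -
  obtain x where "blinfun_apply f x \<noteq> 0"
    using assms by (metis blinfun_eqI zero_blinfun.rep_eq)
  then have "blinfun_apply f (x /\<^sub>R blinfun_apply f x) = 1"
    by (simp add: blinfun.scaleR_right)
  then show thesis by (rule that)
qed

text \<open>The closed half space where \<open>f\<close> is at least the supremum is at distance
  zero from \<open>C\<close>: a point of \<open>C\<close> whose value is within \<open>r\<close> of
  the supremum is moved into it by \<open>r *\<^sub>R w\<close>, where \<open>f\<close> is 1 at
  \<open>w\<close>. Hence it meets \<open>C\<close>, and a common point is a maximizer.\<close>

lemma strong_separation_property_attains_Sup:
  fixes f :: "'a::real_normed_vector \<Rightarrow>\<^sub>L real"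
  assumes ssp: "strong_separation_property C" and "C \<noteq> {}" and f: "f \<in> barrier_cone C" "f \<noteq> 0"
  obtains c where "c \<in> C" "\<And>x. x \<in> C \<Longrightarrow> blinfun_apply f x \<le> blinfun_apply f c"
proof -
  let ?s = "SUP c\<in>C. blinfun_apply f c"
  let ?D = "{x. ?s \<le> blinfun_apply f x}"
  have bdd: "bdd_above (blinfun_apply f ` C)"
    using f(1) unfolding barrier_cone_iff by (auto simp: bdd_above_def)
  obtain w where w: "blinfun_apply f w = 1"
    using f(2) by (rule blinfun_real_normalized)
  have "C \<inter> ?D \<noteq> {}"
  proof (rule strong_separation_property_intersects[OF ssp])
    have "?s *\<^sub>R w \<in> ?D" using w by (simp add: blinfun.scaleR_right)
    then show "?D \<noteq> {}" by blast
    show "closed ?D"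
      by (intro closed_Collect_le continuous_intros)
    show "convex ?D"
    proof (rule convexI)
      fix x y and u v :: real
      assume "x \<in> ?D" "y \<in> ?D" and uv: "0 \<le> u" "0 \<le> v" "u + v = 1"
      then have "u * ?s + v * ?s \<le> u * blinfun_apply f x + v * blinfun_apply f y"
        by (intro add_mono mult_left_mono) auto
      moreover have "u * ?s + v * ?s = ?s"
        using uv(3) by (metis distrib_right mult_1)
      ultimately show "u *\<^sub>R x + v *\<^sub>R y \<in> ?D"
        by (simp add: blinfun.add_right blinfun.scaleR_right)
    qed
    fix e :: real assume "e > 0"
    define r where "r = e / (norm w + 1)"
    have n: "norm w + 1 > 0" by (simp add: add_nonneg_pos)
    have r: "r > 0" using \<open>e > 0\<close> n by (simp add: r_def)
    obtain c where c: "c \<in> C" "?s - r < blinfun_apply f c"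
      using less_cSUP_iff[OF \<open>C \<noteq> {}\<close> bdd, of "?s - r"] r by auto
    have "c + r *\<^sub>R w \<in> ?D"
      using c(2) w by (simp add: blinfun.add_right blinfun.scaleR_right)
    moreover have "dist c (c + r *\<^sub>R w) < e"
    proof -
      have "dist c (c + r *\<^sub>R w) = r * norm w" using r by (simp add: dist_norm)
      also have "\<dots> < r * (norm w + 1)" using r by simp
      also have "\<dots> = e" using n by (simp add: r_def)
      finally show ?thesis .
    qed
    ultimately show "\<exists>c\<in>C. \<exists>d\<in>?D. dist c d < e" using c(1) by blast
  qed
  then obtain c where "c \<in> C" "?s \<le> blinfun_apply f c" by blast
  then show thesis
    by (intro that[of c]) (auto intro: order_trans[OF cSUP_upper[OF _ bdd]])
qed

text \<open>Joining \<open>c\<close> to ever farther points of the given ray, with weights shrinking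
  like the inverse of the distance travelled, gives points of \<open>C\<close> that converge to the
  desired point of the parallel ray from \<open>c\<close>.\<close>

lemma recession_direction_base_point:
  fixes C :: "'a::real_normed_vector set"
  assumes "closed C" "convex C" "c \<in> C" and ray: "\<And>t. t \<ge> 0 \<Longrightarrow> c\<^sub>0 + t *\<^sub>R u \<in> C" and "t \<ge> 0"
  shows "c + t *\<^sub>R u \<in> C"
proof (rule closed_sequentially[OF \<open>closed C\<close>])
  let ?a = "\<lambda>n. inverse (real (Suc n))"
  show "(1 - ?a n) *\<^sub>R c + ?a n *\<^sub>R (c\<^sub>0 + (real (Suc n) * t) *\<^sub>R u) \<in> C" for n
    using \<open>t \<ge> 0\<close>
    by (intro convexD[OF \<open>convex C\<close>] ray \<open>c \<in> C\<close>) (auto simp: field_simps)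
  have "(1 - ?a n) *\<^sub>R c + ?a n *\<^sub>R (c\<^sub>0 + (real (Suc n) * t) *\<^sub>R u)
      = (1 - ?a n) *\<^sub>R c + ?a n *\<^sub>R c\<^sub>0 + t *\<^sub>R u" for n
    by (simp add: scaleR_add_right add.assoc del: of_nat_Suc)
  moreover have "(\<lambda>n. (1 - ?a n) *\<^sub>R c + ?a n *\<^sub>R c\<^sub>0 + t *\<^sub>R u)
      \<longlonglongrightarrow> (1 - 0) *\<^sub>R c + 0 *\<^sub>R c\<^sub>0 + t *\<^sub>R u"
    by (intro tendsto_intros LIMSEQ_inverse_real_of_nat)
  ultimately show "(\<lambda>n. (1 - ?a n) *\<^sub>R c + ?a n *\<^sub>R (c\<^sub>0 + (real (Suc n) * t) *\<^sub>R u))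
      \<longlonglongrightarrow> c + t *\<^sub>R u"
    by (simp add: add.assoc)
qed

text \<open>The set \<open>D\<close> below is the analogue of the region above a hyperbola branch that is asymptotic
  to the ray. Writing it with the distance to the ray makes a functional that is
  nonzero at \<open>u\<close> (and with it the Hahn--Banach theorem) unnecessary.\<close>

lemma strong_separation_property_no_flat_direction:
  fixes f :: "'a::real_normed_vector \<Rightarrow>\<^sub>L real"
  assumes C: "closed C" "convex C" and ssp: "strong_separation_property C"
    and f: "f \<in> barrier_cone C" "f \<noteq> 0"
    and ray: "\<And>t. t \<ge> 0 \<Longrightarrow> c\<^sub>0 + t *\<^sub>R u \<in> C" and "u \<noteq> 0"
  shows "blinfun_apply f u \<noteq> 0"
proof
  assume fu: "blinfun_apply f u = 0"
  have "C \<noteq> {}" using ray[of 0] by auto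
  then obtain c where c: "c \<in> C" "\<And>x. x \<in> C \<Longrightarrow> blinfun_apply f x \<le> blinfun_apply f c"
    using ssp f strong_separation_property_attains_Sup by metis
  obtain w where w: "blinfun_apply f w = 1"
    using f(2) by (rule blinfun_real_normalized)
  \<comment> \<open>The factor makes each \<open>d n\<close> satisfy the inequality defining
    \<open>D\<close> with equality at \<open>t = n\<close>: \<open>norm w\<close> pays for the
    distance to the ray and the extra 1 for the term \<open>inverse (1 + t)\<close>.\<close>
  define K where "K = norm w + 1"
  have K: "K > 0" by (simp add: K_def add_nonneg_pos)
  define h where "h x = K * (blinfun_apply f x - blinfun_apply f c)" for x
  have hC: "h x \<le> 0" if "x \<in> C" for x
    using c(2)[OF that] K by (simp add: h_def mult_le_0_iff)
  have h_cont: "continuous_on UNIV h"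
    unfolding h_def by (intro continuous_intros)
  \<comment> \<open>Since \<open>inverse (1 + t)\<close> is positive, \<open>h\<close> is positive
    on \<open>D\<close>, whereas \<open>h\<close> is at most 0 on \<open>C\<close>. So the sets are
    disjoint, although the added term fades far out along the ray.\<close>
  define D where "D = {x. \<exists>t\<ge>0. norm (x - c - t *\<^sub>R u) + inverse (1 + t) \<le> h x}"
  define d where "d n = c + real n *\<^sub>R u + inverse (1 + real n) *\<^sub>R w" for n
  have dD: "d n \<in> D" for n
  proof -
    have "norm (d n - c - real n *\<^sub>R u) + inverse (1 + real n) = K * inverse (1 + real n)"
      by (simp add: d_def K_def algebra_simps)
    also have "\<dots> = h (d n)"
      using fu w by (simp add: h_def d_def blinfun.add_right blinfun.scaleR_right)
    finally show ?thesis unfolding D_def by (intro CollectI exI[of _ "real n"]) auto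
  qed
  have "C \<inter> D \<noteq> {}"
  proof (rule strong_separation_property_intersects[OF ssp])
    show "D \<noteq> {}" using dD by blast
    show "closed D"
      unfolding closed_sequential_limits
    proof (intro allI impI)
      fix x l assume "(\<forall>n. x n \<in> D) \<and> x \<longlonglongrightarrow> l"
      then have x: "\<And>n. x n \<in> D" and l: "x \<longlonglongrightarrow> l" by auto
      from x obtain t where t: "\<And>n. t n \<ge> 0"
        "\<And>n. norm (x n - c - t n *\<^sub>R u) + inverse (1 + t n) \<le> h (x n)"
        unfolding D_def by simp metis
      have hl: "(\<lambda>n. h (x n)) \<longlonglongrightarrow> h l"
        using l by (intro continuous_on_tendsto_compose[OF h_cont]) auto
      have "Bseq (\<lambda>n. h (x n))" "Bseq (\<lambda>n. x n - c)"
        using hl tendsto_diff[OF l tendsto_const, of c] convergent_imp_Bseq convergentI by blast+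
      then obtain A B where A: "\<And>n. norm (h (x n)) \<le> A" and B: "\<And>n. norm (x n - c) \<le> B"
        unfolding Bseq_def by blast
      \<comment> \<open>A projection along \<open>t\<close> need not be closed. Here
        \<open>u \<noteq> 0\<close> bounds the parameters of a convergent sequence in
        \<open>D\<close>, so that a subsequence of them converges and the inequality passes to the
        limit.\<close>
      have "t n \<le> (A + B) / norm u" for n
      proof -
        have "t n * norm u = norm (t n *\<^sub>R u)" using t(1) by simp
        also have "\<dots> \<le> norm (x n - c - t n *\<^sub>R u) + norm (x n - c)"
          by (metis add.commute diff_add_cancel norm_minus_commute norm_triangle_sub)
        also have "norm (x n - c - t n *\<^sub>R u) \<le> h (x n)"
          using t(2)[of n] t(1)[of n] inverse_nonnegative_iff_nonnegative[of "1 + t n"] by linarith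
        also have "\<dots> \<le> A" using A[of n] by simp
        finally show ?thesis using B[of n] \<open>u \<noteq> 0\<close> by (simp add: field_simps)
      qed
      then have "\<forall>n. t n \<in> {0..(A + B) / norm u}" using t(1) by auto
      then obtain k r where k: "k \<in> {0..(A + B) / norm u}" "strict_mono r" "(t \<circ> r) \<longlonglongrightarrow> k"
        using compact_Icc[of 0 "(A + B) / norm u", unfolded compact_def] by blast
      have xr: "(\<lambda>n. x (r n)) \<longlonglongrightarrow> l" "(\<lambda>n. h (x (r n))) \<longlonglongrightarrow> h l" "(\<lambda>n. t (r n)) \<longlonglongrightarrow> k"
        using LIMSEQ_subseq_LIMSEQ[OF l k(2)] LIMSEQ_subseq_LIMSEQ[OF hl k(2)] k(3)
        by (auto simp: o_def)
      have "norm (l - c - k *\<^sub>R u) + inverse (1 + k) \<le> h l"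
      proof (rule LIMSEQ_le[OF _ xr(2)])
        show "(\<lambda>n. norm (x (r n) - c - t (r n) *\<^sub>R u) + inverse (1 + t (r n)))
            \<longlonglongrightarrow> norm (l - c - k *\<^sub>R u) + inverse (1 + k)"
          using k(1) by (intro tendsto_intros xr) auto
      qed (use t(2) in blast)
      then show "l \<in> D" using k(1) unfolding D_def by auto
    qed
    \<comment> \<open>\<open>D\<close> is the projection of a set of pairs \<open>(x, t)\<close> cut
      out by a jointly convex inequality: the norm of an affine expression plus the convex function
      \<open>inverse\<close>, bounded by the affine \<open>h\<close>. The parameters are combined
      with the same weights as the points.\<close>
    show "convex D"
    proof (rule convexI)
      fix x y and a b :: real
      assume "x \<in> D" "y \<in> D" and ab: "0 \<le> a" "0 \<le> b" "a + b = 1"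
      then obtain t s where t: "t \<ge> 0" "norm (x - c - t *\<^sub>R u) + inverse (1 + t) \<le> h x"
        and s: "s \<ge> 0" "norm (y - c - s *\<^sub>R u) + inverse (1 + s) \<le> h y"
        unfolding D_def by blast
      have b: "b = 1 - a" using ab by simp
      have "a *\<^sub>R x + b *\<^sub>R y - c - (a * t + b * s) *\<^sub>R u
          = a *\<^sub>R (x - c - t *\<^sub>R u) + b *\<^sub>R (y - c - s *\<^sub>R u)"
        by (simp add: b algebra_simps)
      then have 1: "norm (a *\<^sub>R x + b *\<^sub>R y - c - (a * t + b * s) *\<^sub>R u)
          \<le> a * norm (x - c - t *\<^sub>R u) + b * norm (y - c - s *\<^sub>R u)"
        using norm_triangle_ineq[of "a *\<^sub>R (x - c - t *\<^sub>R u)" "b *\<^sub>R (y - c - s *\<^sub>R u)"] ab by simp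
      have 2: "inverse (1 + (a * t + b * s)) \<le> a * inverse (1 + t) + b * inverse (1 + s)"
      proof -
        have "convex_on {0<..} (inverse :: real \<Rightarrow> real)"
          by (rule convex_on_inverse) auto
        from convex_onD[OF this, of b "1 + t" "1 + s"] show ?thesis
          using ab t(1) s(1) by (simp add: b algebra_simps)
      qed
      have "h (a *\<^sub>R x + b *\<^sub>R y) = a * h x + b * h y"
        unfolding h_def blinfun.add_right blinfun.scaleR_right b by (simp add: algebra_simps)
      moreover have "a * (norm (x - c - t *\<^sub>R u) + inverse (1 + t)) \<le> a * h x"
        "b * (norm (y - c - s *\<^sub>R u) + inverse (1 + s)) \<le> b * h y"
        using t s ab by (auto intro: mult_left_mono)
      ultimately have "norm (a *\<^sub>R x + b *\<^sub>R y - c - (a * t + b * s) *\<^sub>R u)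
          + inverse (1 + (a * t + b * s)) \<le> h (a *\<^sub>R x + b *\<^sub>R y)"
        using 1 2 by (simp add: distrib_left)
      then show "a *\<^sub>R x + b *\<^sub>R y \<in> D"
        unfolding D_def using ab t(1) s(1) by (intro CollectI exI[of _ "a * t + b * s"]) auto
    qed
    fix e :: real assume "e > 0"
    have "(\<lambda>n. inverse (real (Suc n)) * norm w) \<longlonglongrightarrow> 0 * norm w"
      by (intro tendsto_intros LIMSEQ_inverse_real_of_nat)
    then have "\<forall>\<^sub>F n in sequentially. inverse (real (Suc n)) * norm w < e"
      using \<open>e > 0\<close> by (intro order_tendstoD(2)) auto
    then obtain n where n: "inverse (real (Suc n)) * norm w < e"
      using eventually_happens by fastforce
    \<comment> \<open>The nth point of the ray from \<open>c\<close> and \<open>d n\<close> differ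
      by \<open>w\<close> divided by \<open>n + 1\<close>.\<close>
    have "dist (c + real n *\<^sub>R u) (d n) < e"
      using n by (simp add: d_def dist_norm)
    moreover have "c + real n *\<^sub>R u \<in> C"
      by (rule recession_direction_base_point[OF C c(1) ray]) auto
    ultimately show "\<exists>c\<in>C. \<exists>d\<in>D. dist c d < e" using dD by blast
  qed
  then obtain x t where "x \<in> C" "t \<ge> 0" "norm (x - c - t *\<^sub>R u) + inverse (1 + t) \<le> h x"
    unfolding D_def by blast
  moreover from this have "inverse (1 + t) > 0" by simp
  ultimately show False using hC[of x] norm_ge_zero[of "x - c - t *\<^sub>R u"] by linarith
qed

section \<open>The bidual norm and sequences from the boundary of the barrier cone\<close>

lift_definition bidual_embedding :: "'a::real_normed_vector \<Rightarrow> ('a \<Rightarrow>\<^sub>L real) \<Rightarrow>\<^sub>L real"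
  is "\<lambda>x f. blinfun_apply f x"
  by (rule blinfun.bounded_linear_left)

lemma bidual_embedding_add: "bidual_embedding (x + y) = bidual_embedding x + bidual_embedding y"
  by (rule blinfun_eqI) (simp add: bidual_embedding.rep_eq blinfun.add_left blinfun.add_right)

lemma norm_bidual_embedding_le: "norm (bidual_embedding x) \<le> norm x"
  by (rule norm_blinfun_bound)
    (auto simp: bidual_embedding.rep_eq norm_blinfun mult.commute[of "norm x"] simp flip: real_norm_def)

lemma abs_apply_le_norm_bidual_embedding:
  "\<bar>blinfun_apply f x\<bar> \<le> norm (bidual_embedding x) * norm f"
  using norm_blinfun[of "bidual_embedding x" f] by (simp add: bidual_embedding.rep_eq)

text \<open>Lengths are measured by the norm of the bidual, since without the Hahn--Banach theorem it is
  not available that \<open>bidual_embedding\<close> is isometric.\<close>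

lemma barrier_cone_boundary_sequence:
  fixes f :: "'a::real_normed_vector \<Rightarrow>\<^sub>L real"
  assumes f: "f \<in> barrier_cone C" "f \<notin> interior (barrier_cone C)" and "c\<^sub>0 \<in> C"
  obtains d where "\<And>n. c\<^sub>0 + d n \<in> C"
    "filterlim (\<lambda>n. norm (bidual_embedding (d n))) at_top sequentially"
    "(\<lambda>n. blinfun_apply f (d n) / norm (bidual_embedding (d n))) \<longlonglongrightarrow> 0"
proof -
  let ?p = "\<lambda>x::'a. norm (bidual_embedding x)"
  obtain M where M: "\<And>c. c \<in> C \<Longrightarrow> blinfun_apply f c \<le> M"
    using f(1) unfolding barrier_cone_iff by blast
  define S where "S = M - blinfun_apply f c\<^sub>0"
  \<comment> \<open>Arbitrarily near \<open>f\<close> there is a functional \<open>h\<close>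
    unbounded above on \<open>C\<close>. Choose \<open>c\<close> where
    \<open>h (c - c\<^sub>0)\<close> exceeds \<open>n\<close>; replacing \<open>h\<close> by
    \<open>f\<close> costs at most the bidual norm of \<open>c - c\<^sub>0\<close> divided by
    \<open>n + 1\<close>.\<close>
  have "\<exists>d. c\<^sub>0 + d \<in> C \<and> real n - ?p d / real (Suc n) \<le> blinfun_apply f d" for n
  proof -
    have "\<not> ball f (inverse (real (Suc n))) \<subseteq> barrier_cone C"
      using f(2) unfolding mem_interior by (metis inverse_positive_iff_positive of_nat_0_less_iff zero_less_Suc)
    then obtain h where h: "dist f h < inverse (real (Suc n))" "h \<notin> barrier_cone C"
      by (auto simp: subset_iff)
    obtain c where c: "c \<in> C" "\<not> blinfun_apply h c \<le> real n + blinfun_apply h c\<^sub>0"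
      using h(2) unfolding barrier_cone_iff by blast
    have "\<bar>blinfun_apply (h - f) (c - c\<^sub>0)\<bar> \<le> ?p (c - c\<^sub>0) * norm (h - f)"
      by (rule abs_apply_le_norm_bidual_embedding)
    also have "\<dots> \<le> ?p (c - c\<^sub>0) * inverse (real (Suc n))"
      using h(1) by (intro mult_left_mono) (auto simp: dist_norm norm_minus_commute)
    finally have "real n - ?p (c - c\<^sub>0) / real (Suc n) \<le> blinfun_apply f (c - c\<^sub>0)"
      using c(2) unfolding divide_inverse by (simp add: blinfun.diff_left blinfun.diff_right)
    then show ?thesis using c(1) by (intro exI[of _ "c - c\<^sub>0"]) auto
  qed
  then obtain d where d: "\<And>n. c\<^sub>0 + d n \<in> C"
    "\<And>n. real n - ?p (d n) / real (Suc n) \<le> blinfun_apply f (d n)"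
    by metis
  have fS: "blinfun_apply f (d n) \<le> S" for n
    using M[OF d(1)[of n]] by (simp add: S_def blinfun.add_right)
  \<comment> \<open>As \<open>f\<close> is bounded by \<open>S\<close> along \<open>d\<close>, the
    large value of the perturbed functional can only be due to the length of \<open>d n\<close>,
    which therefore grows at least quadratically.\<close>
  have low: "(real n - S) * real (Suc n) \<le> ?p (d n)" for n
  proof -
    have "real n - S \<le> ?p (d n) / real (Suc n)" using d(2)[of n] fS[of n] by linarith
    then show ?thesis by (simp add: pos_le_divide_eq del: of_nat_Suc)
  qed
  have ev: "\<forall>\<^sub>F n in sequentially. real n \<le> ?p (d n) \<and> 0 < ?p (d n)"
  proof (rule eventually_sequentiallyI)
    fix n :: nat assume "nat \<lceil>S + 1\<rceil> \<le> n"
    then have "1 \<le> real n - S" by linarith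
    then have "1 * real (Suc n) \<le> (real n - S) * real (Suc n)"
      by (intro mult_right_mono) auto
    from order_trans[OF this low] have *: "1 + real n \<le> norm (bidual_embedding (d n))" by simp
    show "real n \<le> ?p (d n) \<and> 0 < ?p (d n)"
      by (intro conjI) (use * in linarith)+
  qed
  have lim: "filterlim (\<lambda>n. ?p (d n)) at_top sequentially"
    by (rule filterlim_at_top_mono[OF filterlim_real_sequentially]) (use ev in eventually_elim, simp)
  have "(\<lambda>n. blinfun_apply f (d n) / ?p (d n)) \<longlonglongrightarrow> 0"
  proof (rule tendsto_sandwich)
    show "\<forall>\<^sub>F n in sequentially. - inverse (real (Suc n)) \<le> blinfun_apply f (d n) / ?p (d n)"
      using ev
    proof eventually_elim
      case (elim n)
      have "- inverse (real (Suc n)) * ?p (d n) \<le> blinfun_apply f (d n)"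
        using d(2)[of n] by (simp add: divide_inverse mult.commute)
      then show ?case using elim pos_le_divide_eq by blast
    qed
    show "\<forall>\<^sub>F n in sequentially. blinfun_apply f (d n) / ?p (d n) \<le> S / ?p (d n)"
      using fS by (intro always_eventually allI divide_right_mono) auto
    show "(\<lambda>n. - inverse (real (Suc n))) \<longlonglongrightarrow> 0"
      using tendsto_minus[OF LIMSEQ_inverse_real_of_nat] by simp
    show "(\<lambda>n. S / ?p (d n)) \<longlonglongrightarrow> 0"
      by (rule tendsto_divide_0[OF tendsto_const filterlim_at_top_imp_at_infinity[OF lim]])
  qed
  then show thesis using that d(1) lim by blast
qed

text \<open>The bidual norm is at most the norm. Passing to the norm thus keeps the divergence of
  the lengths and only shrinks the absolute values of the quotients.\<close>

lemma barrier_cone_boundary_unit_sequence: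
  fixes f :: "'a::real_normed_vector \<Rightarrow>\<^sub>L real"
  assumes f: "f \<in> barrier_cone C" "f \<notin> interior (barrier_cone C)" and "c\<^sub>0 \<in> C"
  obtains d where "\<And>n. c\<^sub>0 + d n \<in> C" "filterlim (\<lambda>n. norm (d n)) at_top sequentially"
    "(\<lambda>n. blinfun_apply f (d n /\<^sub>R norm (d n))) \<longlonglongrightarrow> 0"
proof -
  obtain d where d: "\<And>n. c\<^sub>0 + d n \<in> C"
    "filterlim (\<lambda>n. norm (bidual_embedding (d n))) at_top sequentially"
    "(\<lambda>n. blinfun_apply f (d n) / norm (bidual_embedding (d n))) \<longlonglongrightarrow> 0"
    using barrier_cone_boundary_sequence[OF assms] by metis
  have "filterlim (\<lambda>n. norm (d n)) at_top sequentially"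
    by (rule filterlim_at_top_mono[OF d(2)]) (simp add: norm_bidual_embedding_le)
  moreover have "(\<lambda>n. blinfun_apply f (d n /\<^sub>R norm (d n))) \<longlonglongrightarrow> 0"
  proof (rule Lim_null_comparison[OF _ tendsto_rabs_zero[OF d(3)]])
    have "\<forall>\<^sub>F n in sequentially. norm (bidual_embedding (d n)) > 0"
      using d(2) by (simp only: filterlim_at_top_dense)
    then show "\<forall>\<^sub>F n in sequentially. norm (blinfun_apply f (d n /\<^sub>R norm (d n)))
        \<le> \<bar>blinfun_apply f (d n) / norm (bidual_embedding (d n))\<bar>"
    proof eventually_elim
      case (elim n)
      have "\<bar>blinfun_apply f (d n)\<bar> / norm (d n) \<le> \<bar>blinfun_apply f (d n)\<bar> / norm (bidual_embedding (d n))"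
        using elim norm_bidual_embedding_le[of "d n"] by (intro divide_left_mono mult_pos_pos) linarith+
      then show ?case
        by (simp add: blinfun.scaleR_right abs_mult abs_divide divide_inverse mult.commute)
    qed
  qed
  ultimately show thesis using that d(1) by blast
qed

section \<open>Cases in which the directions converge in norm\<close>

text \<open>The scale \<open>p\<close> is left free because it is used both with the norm and with
  the bidual norm of \<open>d\<close>.\<close>

lemma convex_segment_of_ray:
  assumes "convex C" "c\<^sub>0 \<in> C" "c\<^sub>0 + d \<in> C" "0 \<le> t" "t \<le> p" "0 < p"
  shows "c\<^sub>0 + t *\<^sub>R (d /\<^sub>R p) \<in> C"
proof -
  have "(1 - t / p) *\<^sub>R c\<^sub>0 + (t / p) *\<^sub>R (c\<^sub>0 + d) \<in> C"
    using assms by (intro convexD) (auto simp: field_simps)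
  then show ?thesis by (simp add: algebra_simps divide_inverse)
qed

text \<open>The common core of the locally compact and the finite-dimensional case:
  \<open>dir\<close> isolates the compactness that they have to supply. The limit \<open>u\<close>
  has \<open>f u = 0\<close> by continuity, and it is a recession direction because the segments
  from \<open>c\<^sub>0\<close> to \<open>c\<^sub>0 + d n\<close> become arbitrarily long and
  \<open>C\<close> is closed.\<close>

lemma barrier_cone_interior_of_direction:
  fixes f :: "'a::real_normed_vector \<Rightarrow>\<^sub>L real"
  assumes C: "closed C" "convex C" and ssp: "strong_separation_property C"
    and f: "f \<in> barrier_cone C" "f \<noteq> 0" and c\<^sub>0: "c\<^sub>0 \<in> C"
    and dir: "\<And>d. \<lbrakk>\<And>n. c\<^sub>0 + d n \<in> C; filterlim (\<lambda>n. norm (d n)) at_top sequentially\<rbrakk>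
      \<Longrightarrow> \<exists>r u. strict_mono r \<and> u \<noteq> 0 \<and> (\<lambda>n. d (r n) /\<^sub>R norm (d (r n))) \<longlonglongrightarrow> u"
  shows "f \<in> interior (barrier_cone C)"
proof (rule ccontr)
  assume "f \<notin> interior (barrier_cone C)"
  then obtain d where d: "\<And>n. c\<^sub>0 + d n \<in> C" "filterlim (\<lambda>n. norm (d n)) at_top sequentially"
    "(\<lambda>n. blinfun_apply f (d n /\<^sub>R norm (d n))) \<longlonglongrightarrow> 0"
    using barrier_cone_boundary_unit_sequence[OF f(1) _ c\<^sub>0] by blast
  then obtain r u where r: "strict_mono r" and u: "u \<noteq> 0"
    and lim: "(\<lambda>n. d (r n) /\<^sub>R norm (d (r n))) \<longlonglongrightarrow> u"
    using dir[of d] by auto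
  have "(\<lambda>n. blinfun_apply f (d (r n) /\<^sub>R norm (d (r n)))) \<longlonglongrightarrow> blinfun_apply f u"
    by (intro tendsto_intros lim)
  moreover have "(\<lambda>n. blinfun_apply f (d (r n) /\<^sub>R norm (d (r n)))) \<longlonglongrightarrow> 0"
    using LIMSEQ_subseq_LIMSEQ[OF d(3) r] by (simp add: o_def)
  ultimately have "blinfun_apply f u = 0"
    using LIMSEQ_unique by blast
  moreover have "c\<^sub>0 + t *\<^sub>R u \<in> C" if "t \<ge> 0" for t
  proof (rule Lim_in_closed_set[OF C(1)])
    have "filterlim (\<lambda>n. norm (d (r n))) at_top sequentially"
      using filterlim_compose[OF d(2) filterlim_subseq[OF r]] by (simp add: o_def)
    then have "\<forall>\<^sub>F n in sequentially. t < norm (d (r n))"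
      by (simp only: filterlim_at_top_dense)
    then show "\<forall>\<^sub>F n in sequentially. c\<^sub>0 + t *\<^sub>R (d (r n) /\<^sub>R norm (d (r n))) \<in> C"
    proof eventually_elim
      case (elim n)
      then show ?case using that by (intro convex_segment_of_ray C c\<^sub>0 d) auto
    qed
    show "(\<lambda>n. c\<^sub>0 + t *\<^sub>R (d (r n) /\<^sub>R norm (d (r n)))) \<longlonglongrightarrow> c\<^sub>0 + t *\<^sub>R u"
      by (intro tendsto_intros lim)
  qed simp
  ultimately show False
    using strong_separation_property_no_flat_direction[OF C ssp f _ u] by blast
qed

lemma barrier_cone_interior_locally_compact:
  fixes f :: "'a::real_normed_vector \<Rightarrow>\<^sub>L real"
  assumes C: "closed C" "convex C" "strong_separation_property C" "locally_compact_convex C"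
    and f: "f \<in> barrier_cone C" "f \<noteq> 0"
  shows "f \<in> interior (barrier_cone C)"
proof -
  obtain c\<^sub>0 e where c\<^sub>0: "c\<^sub>0 \<in> C" and e: "e > 0" "compact (cball c\<^sub>0 e \<inter> C)"
    using C(4) unfolding locally_compact_convex_def by blast
  show ?thesis
  proof (rule barrier_cone_interior_of_direction[OF C(1-3) f c\<^sub>0])
    fix d :: "nat \<Rightarrow> 'a"
    assume d: "\<And>n. c\<^sub>0 + d n \<in> C" and lim: "filterlim (\<lambda>n. norm (d n)) at_top sequentially"
    obtain N where N: "\<And>n. n \<ge> N \<Longrightarrow> norm (d n) > e"
      using lim unfolding filterlim_at_top_dense eventually_sequentially by blast
    \<comment> \<open>The shift by \<open>N\<close> discards the terms of length at most
      \<open>e\<close>, so that each remaining segment in \<open>C\<close> reaches distance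
      \<open>e\<close> from \<open>c\<^sub>0\<close> and yields a point of the compact set.\<close>
    define x where "x n = d (n + N) /\<^sub>R norm (d (n + N))" for n
    have nx: "norm (x n) = 1" for n
    proof -
      have "norm (d (n + N)) > 0" using N[of "n + N"] e(1) by linarith
      then show ?thesis by (simp add: x_def)
    qed
    have "c\<^sub>0 + e *\<^sub>R x n \<in> cball c\<^sub>0 e \<inter> C" for n
    proof
      show "c\<^sub>0 + e *\<^sub>R x n \<in> cball c\<^sub>0 e" using nx e(1) by (simp add: dist_norm)
      show "c\<^sub>0 + e *\<^sub>R x n \<in> C"
        unfolding x_def
        using N[of "n + N"] e(1) by (intro convex_segment_of_ray C c\<^sub>0 d) linarith+
    qed
    then obtain l r where r: "strict_mono r" "((\<lambda>n. c\<^sub>0 + e *\<^sub>R x n) \<circ> r) \<longlonglongrightarrow> l"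
      using e(2) unfolding compact_def by metis
    define u where "u = (l - c\<^sub>0) /\<^sub>R e"
    have "(\<lambda>n. (((\<lambda>n. c\<^sub>0 + e *\<^sub>R x n) \<circ> r) n - c\<^sub>0) /\<^sub>R e) \<longlonglongrightarrow> u"
      unfolding u_def by (intro tendsto_intros r)
    then have xu: "(\<lambda>n. x (r n)) \<longlonglongrightarrow> u" using e(1) by (simp add: o_def)
    then have "norm u = 1"
      using tendsto_norm[OF xu] nx by (simp add: LIMSEQ_const_iff)
    moreover have "strict_mono (\<lambda>n. r n + N)" using r(1) by (simp add: strict_mono_def)
    ultimately show "\<exists>r u. strict_mono r \<and> u \<noteq> 0 \<and> (\<lambda>n. d (r n) /\<^sub>R norm (d (r n))) \<longlonglongrightarrow> u"
      using xu unfolding x_def by (intro exI[of _ "\<lambda>n. r n + N"] exI[of _ u]) auto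
  qed
qed

text \<open>Induction on the spanning set. The induction hypothesis makes \<open>span B\<close>
  closed, so a new vector \<open>b\<close> has positive distance from it. This bounds the
  coefficient of \<open>b\<close>, and the two components converge along nested
  subsequences.\<close>

lemma bounded_sequence_in_finite_span_subsequence:
  fixes x :: "nat \<Rightarrow> 'a::real_normed_vector"
  assumes "finite B" "\<And>n. x n \<in> span B" "bounded (range x)"
  obtains l r where "l \<in> span B" "strict_mono r" "(\<lambda>n. x (r n)) \<longlonglongrightarrow> l"
proof -
  have "\<forall>x :: nat \<Rightarrow> 'a. (\<forall>n. x n \<in> span B) \<and> bounded (range x) \<longrightarrow>
      (\<exists>l\<in>span B. \<exists>r. strict_mono r \<and> (\<lambda>n. x (r n)) \<longlonglongrightarrow> l)"
    using \<open>finite B\<close>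
  proof (induction B)
    case empty
    have "Ex (strict_mono :: (nat \<Rightarrow> nat) \<Rightarrow> bool)"
      by (rule exI[of _ "\<lambda>n. n"]) (simp add: strict_mono_def)
    then show ?case by simp
  next
    case (insert b B)
    show ?case
    proof (cases "b \<in> span B")
      case True
      then show ?thesis using insert.IH by (simp add: span_redundant)
    next
      case False
      have closed: "closed (span B)"
        unfolding closed_sequential_limits
      proof (intro allI impI)
        fix y l assume y: "(\<forall>n. y n \<in> span B) \<and> y \<longlonglongrightarrow> l"
        then have "bounded (range y)" using convergent_imp_bounded by blast
        then obtain l' r where "l' \<in> span B" "strict_mono r" "(\<lambda>n. y (r n)) \<longlonglongrightarrow> l'"
          using insert.IH y by blast
        moreover have "(\<lambda>n. y (r n)) \<longlonglongrightarrow> l"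
          using LIMSEQ_subseq_LIMSEQ[of y l r] y \<open>strict_mono r\<close> by (simp add: o_def)
        ultimately show "l \<in> span B" using LIMSEQ_unique by blast
      qed
      obtain \<delta> where "\<delta> > 0" "ball b \<delta> \<subseteq> - span B"
        using closed False open_contains_ball[of "- span B"] by (auto simp: open_Compl)
      then have \<delta>: "\<delta> > 0" "\<And>z. z \<in> span B \<Longrightarrow> \<delta> \<le> dist b z"
        by (force simp: subset_iff not_less)+
      show ?thesis
      proof (intro allI impI)
        fix x :: "nat \<Rightarrow> 'a" assume x: "(\<forall>n. x n \<in> span (insert b B)) \<and> bounded (range x)"
        then have "\<forall>n. \<exists>k. x n - k *\<^sub>R b \<in> span B" by (simp add: span_breakdown_eq)
        then obtain k where k: "\<And>n. x n - k n *\<^sub>R b \<in> span B" by metis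
        obtain A where A: "\<And>n. norm (x n) \<le> A"
          using x unfolding bounded_iff by auto
        have k_le: "\<bar>k n\<bar> \<le> A / \<delta>" for n
        proof (cases "k n = 0")
          case True
          then show ?thesis using A[of n] \<delta>(1) norm_ge_zero[of "x n"] by (simp del: norm_ge_zero)
        next
          case False
          \<comment> \<open>Dividing by the coefficient of \<open>b\<close> exhibits
            \<open>norm (x n) / \<bar>k n\<bar>\<close> as the distance from \<open>b\<close> to a
            point of \<open>span B\<close>, hence as at least \<open>\<delta>\<close>.\<close>
          have "- (inverse (k n) *\<^sub>R (x n - k n *\<^sub>R b)) \<in> span B"
            by (intro span_neg span_scale k)
          then have "\<delta> \<le> dist b (- (inverse (k n) *\<^sub>R (x n - k n *\<^sub>R b)))" by (rule \<delta>(2))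
          also have "\<dots> = norm (x n) / \<bar>k n\<bar>"
            using False by (simp add: dist_norm algebra_simps divide_inverse)
          finally have "\<delta> * \<bar>k n\<bar> \<le> A" using False A[of n] by (simp add: field_simps)
          then show ?thesis using \<delta>(1) by (simp add: field_simps)
        qed
        then have "bounded (range k)" unfolding bounded_iff by auto
        then obtain m r where r: "strict_mono r" "(k \<circ> r) \<longlonglongrightarrow> m"
          using bounded_imp_convergent_subsequence by blast
        have "norm (x (r n) - k (r n) *\<^sub>R b) \<le> A + A / \<delta> * norm b" for n
        proof -
          have "norm (x (r n) - k (r n) *\<^sub>R b) \<le> norm (x (r n)) + \<bar>k (r n)\<bar> * norm b"
            using norm_triangle_ineq4[of "x (r n)" "k (r n) *\<^sub>R b"] by simp
          also have "\<dots> \<le> A + A / \<delta> * norm b"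
            by (intro add_mono mult_right_mono A k_le) auto
          finally show ?thesis .
        qed
        then have "bounded (range (\<lambda>n. x (r n) - k (r n) *\<^sub>R b))" unfolding bounded_iff by blast
        then obtain l s where l: "l \<in> span B" and s: "strict_mono s"
          "(\<lambda>n. x (r (s n)) - k (r (s n)) *\<^sub>R b) \<longlonglongrightarrow> l"
          using insert.IH[rule_format, of "\<lambda>n. x (r n) - k (r n) *\<^sub>R b"] k by blast
        have "(\<lambda>n. k (r (s n))) \<longlonglongrightarrow> m"
          using LIMSEQ_subseq_LIMSEQ[OF r(2) s(1)] by (simp add: o_def)
        then have "(\<lambda>n. (x (r (s n)) - k (r (s n)) *\<^sub>R b) + k (r (s n)) *\<^sub>R b) \<longlonglongrightarrow> l + m *\<^sub>R b"
          by (intro tendsto_intros s)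
        then have "(\<lambda>n. x ((r \<circ> s) n)) \<longlonglongrightarrow> l + m *\<^sub>R b" by simp
        moreover have "l + m *\<^sub>R b \<in> span (insert b B)"
          using l by (auto simp: span_breakdown_eq intro!: exI[of _ m])
        ultimately show "\<exists>l\<in>span (insert b B). \<exists>r. strict_mono r \<and> (\<lambda>n. x (r n)) \<longlonglongrightarrow> l"
          using strict_mono_o[OF r(1) s(1)] by blast
      qed
    qed
  qed
  then show thesis using that assms by blast
qed

text \<open>The part of \<open>c\<^sub>0 + d n\<close> in the ball vanishes after division by
  \<open>norm (d n)\<close>. The directions therefore have the same limits as the bounded sequence
  \<open>y\<close> in \<open>Z\<close>, where compactness is available.\<close>

lemma barrier_cone_interior_finite_dim:
  fixes f :: "'a::real_normed_vector \<Rightarrow>\<^sub>L real"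
  assumes C: "closed C" "convex C" "strong_separation_property C"
    and Z: "finite_dim_subspace Z" "C \<subseteq> ball 0 \<rho> + Z"
    and f: "f \<in> barrier_cone C" "f \<noteq> 0" and c\<^sub>0: "c\<^sub>0 \<in> C"
  shows "f \<in> interior (barrier_cone C)"
proof (rule barrier_cone_interior_of_direction[OF C f c\<^sub>0])
  fix d :: "nat \<Rightarrow> 'a"
  assume d: "\<And>n. c\<^sub>0 + d n \<in> C" and lim: "filterlim (\<lambda>n. norm (d n)) at_top sequentially"
  obtain B where B: "finite B" "Z = span B"
    using Z(1) unfolding finite_dim_subspace_def by blast
  define x where "x n = d n /\<^sub>R norm (d n)" for n
  have "\<exists>b z. norm b < \<rho> \<and> z \<in> Z \<and> c\<^sub>0 + d n = b + z" for n
    using Z(2) d[of n] by (force simp: set_plus_def)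
  then obtain b z where bz: "\<And>n. norm (b n) < \<rho>" "\<And>n. z n \<in> Z" "\<And>n. c\<^sub>0 + d n = b n + z n"
    by metis
  define y where "y n = z n /\<^sub>R norm (d n)" for n
  have "(\<lambda>n. x n - y n) \<longlonglongrightarrow> 0"
  proof (rule Lim_null_comparison)
    show "\<forall>\<^sub>F n in sequentially. norm (x n - y n) \<le> (\<rho> + norm c\<^sub>0) / norm (d n)"
    proof (intro always_eventually allI)
      fix n
      have "d n - z n = b n - c\<^sub>0" using bz(3)[of n] by (simp add: algebra_simps)
      then have "x n - y n = (b n - c\<^sub>0) /\<^sub>R norm (d n)"
        by (simp add: x_def y_def flip: scaleR_diff_right)
      moreover have "norm (b n - c\<^sub>0) \<le> \<rho> + norm c\<^sub>0"
        using norm_triangle_ineq4[of "b n" c\<^sub>0] bz(1)[of n] by simp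
      ultimately show "norm (x n - y n) \<le> (\<rho> + norm c\<^sub>0) / norm (d n)"
        by (simp add: divide_right_mono divide_inverse_commute mult_left_mono)
    qed
    show "(\<lambda>n. (\<rho> + norm c\<^sub>0) / norm (d n)) \<longlonglongrightarrow> 0"
      by (rule tendsto_divide_0[OF tendsto_const filterlim_at_top_imp_at_infinity[OF lim]])
  qed
  note xy = this
  have nx_le: "norm (x n) \<le> 1" for n by (cases "d n = 0") (simp_all add: x_def)
  have "bounded (range (\<lambda>n. x n - y n))" using xy convergent_imp_bounded by blast
  then obtain A where A: "\<And>n. norm (x n - y n) \<le> A" unfolding bounded_iff by auto
  have "norm (y n) \<le> 1 + A" for n
    using norm_triangle_ineq4[of "x n" "x n - y n"] nx_le[of n] A[of n] by simp
  then have "bounded (range y)" unfolding bounded_iff by blast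
  moreover have "y n \<in> span B" for n
    using bz(2)[of n] B(2) by (simp add: y_def span_scale)
  ultimately obtain u r where r: "strict_mono r" "(\<lambda>n. y (r n)) \<longlonglongrightarrow> u"
    using bounded_sequence_in_finite_span_subsequence[OF B(1)] by metis
  have "(\<lambda>n. (x (r n) - y (r n)) + y (r n)) \<longlonglongrightarrow> 0 + u"
    using LIMSEQ_subseq_LIMSEQ[OF xy r(1)] by (intro tendsto_intros r) (simp add: o_def)
  then have xu: "(\<lambda>n. x (r n)) \<longlonglongrightarrow> u" by simp
  have "\<forall>\<^sub>F n in sequentially. norm (d (r n)) > 0"
    using filterlim_compose[OF lim filterlim_subseq[OF r(1)]]
    by (simp only: o_def filterlim_at_top_dense)
  then have "\<forall>\<^sub>F n in sequentially. norm (x (r n)) = 1"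
    by eventually_elim (simp add: x_def)
  then have "(\<lambda>n. norm (x (r n))) \<longlonglongrightarrow> 1" by (rule tendsto_eventually)
  then have "norm u = 1" using tendsto_norm[OF xu] LIMSEQ_unique by blast
  then show "\<exists>r u. strict_mono r \<and> u \<noteq> 0 \<and> (\<lambda>n. d (r n) /\<^sub>R norm (d (r n))) \<longlonglongrightarrow> u"
    using xu r(1) unfolding x_def by (intro exI[of _ r] exI[of _ u]) auto
qed

section \<open>Limits along ultrafilters and the reflexive case\<close>

text \<open>The minimal elements among the proper filters are the ultrafilters.\<close>

lemma minimal_filter_exists:
  fixes F :: "'a filter"
  assumes "F \<noteq> bot"
  obtains U where "U \<noteq> bot" "U \<le> F" "\<And>G. G \<noteq> bot \<Longrightarrow> G \<le> U \<Longrightarrow> G = U"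
proof -
  let ?A = "{G. G \<noteq> bot \<and> G \<le> F}"
  have "\<exists>m\<in>?A. \<forall>a\<in>?A. m \<ge> a \<longrightarrow> a = m"
  proof (rule predicate_Zorn)
    show "partial_order_on ?A (relation_of (\<ge>) ?A)"
      by (rule partial_order_on_relation_ofI) auto
    fix \<C> assume "\<C> \<in> Chains (relation_of (\<ge>) ?A)"
    then have sub: "\<C> \<subseteq> ?A" and total: "\<And>G H. G \<in> \<C> \<Longrightarrow> H \<in> \<C> \<Longrightarrow> G \<le> H \<or> H \<le> G"
      unfolding Chains_def relation_of_def by blast+
    show "\<exists>u\<in>?A. \<forall>a\<in>\<C>. a \<ge> u"
    proof (cases "\<C> = {}")
      case True
      then show ?thesis using assms by auto
    next
      case False
      \<comment> \<open>On a nonempty chain the infimum contains only events of its members, so it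
        stays proper.\<close>
      have "eventually P (Inf \<C>) \<longleftrightarrow> (\<exists>b\<in>\<C>. eventually P b)" for P
        using False
      proof (rule eventually_Inf_base)
        fix G H assume "G \<in> \<C>" "H \<in> \<C>"
        then show "\<exists>x\<in>\<C>. x \<le> inf G H" using total[of G H] by auto
      qed
      from this[of "\<lambda>_. False"] have "Inf \<C> \<noteq> bot"
        using sub unfolding trivial_limit_def by blast
      moreover have "Inf \<C> \<le> F"
        using False sub by (auto intro: Inf_lower2)
      ultimately show ?thesis by (auto intro: Inf_lower)
    qed
  qed
  then obtain U where "U \<noteq> bot" "U \<le> F" and U: "\<forall>a\<in>?A. U \<ge> a \<longrightarrow> a = U" by auto
  then show thesis using that[of U] by (auto intro: order_trans)
qed

text \<open>Compactness gives a cluster point \<open>l\<close> of \<open>g\<close> along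
  \<open>U\<close>. Refining \<open>U\<close> by the preimages of the neighbourhoods of
  \<open>l\<close> leaves a proper filter, which by minimality is \<open>U\<close> itself; so
  \<open>g\<close> converges to \<open>l\<close>.\<close>

lemma minimal_filter_bounded_convergent:
  fixes g :: "'a \<Rightarrow> real"
  assumes "U \<noteq> bot" and min: "\<And>G. G \<noteq> bot \<Longrightarrow> G \<le> U \<Longrightarrow> G = U" and "\<And>n. \<bar>g n\<bar> \<le> B"
  obtains l where "(g \<longlongrightarrow> l) U"
proof -
  have "filtermap g U \<noteq> bot" using \<open>U \<noteq> bot\<close> by (simp add: filtermap_bot_iff)
  moreover have "\<forall>\<^sub>F x in filtermap g U. x \<in> cball 0 B"
    using assms(3) by (auto simp: eventually_filtermap)
  ultimately obtain l where l: "inf (nhds l) (filtermap g U) \<noteq> bot"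
    using compact_cball[of "0::real" B] unfolding compact_filter by blast
  have "inf (filtercomap g (nhds l)) U \<noteq> bot"
  proof
    assume "inf (filtercomap g (nhds l)) U = bot"
    then obtain P Q where PQ: "eventually P (nhds l)" "eventually Q U" "\<And>x. P (g x) \<Longrightarrow> Q x \<Longrightarrow> False"
      unfolding trivial_limit_def eventually_inf eventually_filtercomap by metis
    have "eventually (\<lambda>y. \<not> P y) (filtermap g U)"
      unfolding eventually_filtermap using PQ(2) by eventually_elim (use PQ(3) in blast)
    then have "eventually (\<lambda>_. False) (inf (nhds l) (filtermap g U))"
      unfolding eventually_inf using PQ(1) by blast
    then show False using l by (simp add: trivial_limit_def)
  qed
  then have "inf (filtercomap g (nhds l)) U = U" by (rule min) simp
  then have "U \<le> filtercomap g (nhds l)" by (metis inf.cobounded1)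
  then show thesis
    using that unfolding filterlim_def by (simp add: filtermap_le_iff_le_filtercomap)
qed

text \<open>The barrier cone is a countable union of the closed sets \<open>A n\<close>. By Baire's
  theorem in the complete dual some \<open>A n\<close> contains a ball around some \<open>h\<close>,
  and the uniform bound over all perturbations of \<open>h\<close> in it produces the norm
  term.\<close>

lemma barrier_cone_interior_coercive:
  fixes C :: "'a::real_normed_vector set"
  assumes "interior (barrier_cone C) \<noteq> {}"
  obtains h \<delta> k where "\<delta> > 0"
    "\<And>c. c \<in> C \<Longrightarrow> blinfun_apply h c + \<delta> * norm (bidual_embedding c) \<le> k"
proof -
  define A where "A n = {h. \<forall>c\<in>C. blinfun_apply h c \<le> real n}" for n :: nat
  have "closed (A n)" for n
  proof -
    have "A n = (\<Inter>c\<in>C. {h. blinfun_apply h c \<le> real n})" by (auto simp: A_def)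
    then show ?thesis by (auto intro!: closed_INT closed_Collect_le continuous_intros)
  qed
  have "barrier_cone C = \<Union>(range A)"
    unfolding set_eq_iff barrier_cone_iff A_def
    by simp (meson order_trans real_arch_simple)
  have "\<exists>n. interior (A n) \<noteq> {}"
  proof (rule ccontr)
    assume "\<nexists>n. interior (A n) \<noteq> {}"
    then have "Met_TC.mtopology interior_of \<Union>(range A) = {}"
      using \<open>\<And>n. closed (A n)\<close>
      by (intro Met_TC.metric_Baire_category_alt) (auto simp: complete_UNIV)
    then show False using assms \<open>barrier_cone C = \<Union>(range A)\<close> by simp
  qed
  then obtain n h e where e: "e > 0" "ball h e \<subseteq> A n"
    by (metis equals0I mem_interior)
  show thesis
  proof
    show "e / 2 > 0" using e by simp
    fix c assume "c \<in> C"
    have *: "blinfun_apply h c + blinfun_apply g c \<le> real n" if "norm g < e" for g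
    proof -
      have "h + g \<in> ball h e" using that by (simp add: dist_norm)
      then show ?thesis using e(2) \<open>c \<in> C\<close> by (auto simp: A_def blinfun.add_left)
    qed
    have hn: "0 \<le> real n - blinfun_apply h c" using *[of 0] e(1) by simp
    have "norm (bidual_embedding c) \<le> (real n - blinfun_apply h c) / (e / 2)"
    proof (rule norm_blinfun_bound)
      show "0 \<le> (real n - blinfun_apply h c) / (e / 2)" using hn e(1) by simp
      fix g :: "'a \<Rightarrow>\<^sub>L real"
      show "norm (blinfun_apply (bidual_embedding c) g) \<le> (real n - blinfun_apply h c) / (e / 2) * norm g"
      proof (cases "g = 0")
        case False
        \<comment> \<open>This scales \<open>g\<close> to norm \<open>e / 2\<close>, strictly inside
          the open ball. Both signs are used, which gives the absolute value.\<close>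
        define s where "s = e / 2 / norm g"
        have s: "s > 0" using False e(1) by (simp add: s_def)
        have "norm (s *\<^sub>R g) < e" "norm (- (s *\<^sub>R g)) < e"
          using False e(1) by (simp_all add: s_def)
        from *[OF this(1)] *[OF this(2)] have "s * \<bar>blinfun_apply g c\<bar> \<le> real n - blinfun_apply h c"
          using s by (auto simp: blinfun.scaleR_left blinfun.minus_left abs_if)
        then have "\<bar>blinfun_apply g c\<bar> \<le> (real n - blinfun_apply h c) / s"
          using s by (simp add: field_simps)
        also have "\<dots> = (real n - blinfun_apply h c) / (e / 2) * norm g"
          by (simp add: s_def)
        finally show ?thesis by (simp add: bidual_embedding.rep_eq)
      qed simp
    qed
    then show "blinfun_apply h c + e / 2 * norm (bidual_embedding c) \<le> real n"
      using e(1) by (simp add: field_simps)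
  qed
qed

lemma barrier_cone_interior_reflexive:
  fixes f :: "'a::real_normed_vector \<Rightarrow>\<^sub>L real"
  assumes C: "closed C" "convex C" and ssp: "strong_separation_property C"
    and refl: "reflexive_space TYPE('a)" and int: "interior (barrier_cone C) \<noteq> {}"
    and f: "f \<in> barrier_cone C" "f \<noteq> 0" and c\<^sub>0: "c\<^sub>0 \<in> C"
  shows "f \<in> interior (barrier_cone C)"
proof (rule ccontr)
  let ?p = "\<lambda>x::'a. norm (bidual_embedding x)"
  assume "f \<notin> interior (barrier_cone C)"
  then obtain d where d: "\<And>n. c\<^sub>0 + d n \<in> C" "filterlim (\<lambda>n. ?p (d n)) at_top sequentially"
    "(\<lambda>n. blinfun_apply f (d n) / ?p (d n)) \<longlonglongrightarrow> 0"
    using barrier_cone_boundary_sequence[OF f(1) _ c\<^sub>0] by metis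
  \<comment> \<open>Normalizing by the bidual norm keeps each \<open>g (x n)\<close> within
    \<open>norm g\<close>, which gives both the ultrafilter limits and the bound on
    \<open>\<phi>\<close>.\<close>
  define x where "x n = d n /\<^sub>R ?p (d n)" for n
  have x_apply: "blinfun_apply g (x n) = blinfun_apply g (d n) / ?p (d n)" for g n
    by (simp add: x_def blinfun.scaleR_right divide_inverse mult.commute)
  have x_le: "\<bar>blinfun_apply g (x n)\<bar> \<le> norm g" for g n
  proof (cases "?p (d n) = 0")
    case False
    then have "?p (d n) > 0" by simp
    then show ?thesis
      using abs_apply_le_norm_bidual_embedding[of g "d n"]
      by (simp add: x_apply abs_divide pos_divide_le_eq mult.commute)
  qed (simp add: x_def)
  obtain U where U: "U \<noteq> bot" "U \<le> sequentially" and min: "\<And>G. G \<noteq> bot \<Longrightarrow> G \<le> U \<Longrightarrow> G = U"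
    using minimal_filter_exists[OF sequentially_bot] by metis
  have "\<exists>l. ((\<lambda>n. blinfun_apply g (x n)) \<longlongrightarrow> l) U" for g :: "'a \<Rightarrow>\<^sub>L real"
    by (rule minimal_filter_bounded_convergent[OF U(1) _ x_le[of g]]) (auto intro: min)
  then obtain \<phi> where \<phi>: "\<And>g :: 'a \<Rightarrow>\<^sub>L real. ((\<lambda>n. blinfun_apply g (x n)) \<longlongrightarrow> \<phi> g) U"
    by metis
  have "bounded_linear \<phi>"
  proof (rule bounded_linear_intro[where K = 1])
    show "\<phi> (g + h) = \<phi> g + \<phi> h" for g h
      using tendsto_unique[OF U(1) \<phi>[of "g + h"]] tendsto_add[OF \<phi>[of g] \<phi>[of h]]
      by (simp add: blinfun.add_left)
    show "\<phi> (a *\<^sub>R g) = a *\<^sub>R \<phi> g" for a g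
      using tendsto_unique[OF U(1) \<phi>[of "a *\<^sub>R g"]] tendsto_scaleR[OF tendsto_const \<phi>[of g]]
      by (simp add: blinfun.scaleR_left)
    show "norm (\<phi> g) \<le> norm g * 1" for g
      using tendsto_upperbound[OF tendsto_norm[OF \<phi>[of g]] _ U(1), of "norm g"] x_le by simp
  qed
  \<comment> \<open>The limit functional belongs to the bidual; reflexivity turns it into a point
    \<open>u\<close>, the weak limit of \<open>x\<close> along \<open>U\<close>.\<close>
  then obtain u where "\<And>g :: 'a \<Rightarrow>\<^sub>L real. \<phi> g = blinfun_apply g u"
    using refl unfolding reflexive_space_def by (metis bounded_linear_Blinfun_apply)
  with \<phi> have u: "((\<lambda>n. blinfun_apply g (x n)) \<longlongrightarrow> blinfun_apply g u) U" for g :: "'a \<Rightarrow>\<^sub>L real"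
    by simp
  have fu: "blinfun_apply f u = 0"
    using tendsto_unique[OF U(1) u] tendsto_mono[OF U(2) d(3)] by (simp add: x_apply)
  have large: "\<forall>\<^sub>F n in U. K < ?p (d n)" for K
    using d(2) U(2) unfolding filterlim_at_top_dense by (meson filter_leD)
  obtain h \<delta> k where h: "\<delta> > 0" "\<And>c. c \<in> C \<Longrightarrow> blinfun_apply h c + \<delta> * ?p c \<le> k"
    using barrier_cone_interior_coercive[OF int] by metis
  \<comment> \<open>Weak limits may lose length. Coercivity prevents \<open>u = 0\<close>: its
    estimate at \<open>c\<^sub>0 + d n\<close>, divided by the bidual norm of \<open>d n\<close>,
    leaves \<open>- \<delta>\<close> plus a vanishing term.\<close>
  have "blinfun_apply h u \<le> - \<delta>"
  proof -
    define L where "L = k - blinfun_apply h c\<^sub>0 + \<delta> * ?p c\<^sub>0"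
    have hd: "blinfun_apply h (d n) \<le> L - \<delta> * ?p (d n)" for n
    proof -
      have "?p (d n) \<le> ?p (c\<^sub>0 + d n) + ?p c\<^sub>0"
        using norm_triangle_ineq4[of "bidual_embedding (c\<^sub>0 + d n)" "bidual_embedding c\<^sub>0"]
        by (simp add: bidual_embedding_add)
      then have "\<delta> * ?p (d n) \<le> \<delta> * ?p (c\<^sub>0 + d n) + \<delta> * ?p c\<^sub>0"
        using h(1) by (simp flip: distrib_left)
      then show ?thesis
        using h(2)[OF d(1)[of n]] by (simp add: L_def blinfun.add_right)
    qed
    have "((\<lambda>n. L / ?p (d n)) \<longlongrightarrow> 0) U"
      using tendsto_divide_0[OF tendsto_const filterlim_at_top_imp_at_infinity[OF d(2)]]
      by (rule tendsto_mono[OF U(2)])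
    then have lim: "((\<lambda>n. L / ?p (d n) - \<delta>) \<longlongrightarrow> 0 - \<delta>) U"
      by (intro tendsto_intros)
    have "\<forall>\<^sub>F n in U. blinfun_apply h (x n) \<le> L / ?p (d n) - \<delta>"
      using large[of 0]
    proof eventually_elim
      case (elim n)
      have "blinfun_apply h (x n) \<le> (L - \<delta> * ?p (d n)) / ?p (d n)"
        unfolding x_apply by (intro divide_right_mono hd) simp
      also have "\<dots> = L / ?p (d n) - \<delta>" using elim by (simp add: diff_divide_distrib)
      finally show ?case .
    qed
    with tendsto_le[OF U(1) lim u] show ?thesis by simp
  qed
  then have "u \<noteq> 0" using h(1) by auto
  moreover have "c\<^sub>0 + t *\<^sub>R u \<in> C" if "t \<ge> 0" for t
  proof (rule ccontr)
    assume "c\<^sub>0 + t *\<^sub>R u \<notin> C"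
    \<comment> \<open>Applied to a singleton, the strong separation property supplies the functional
      that shows \<open>C\<close> to be weakly closed.\<close>
    then have "strongly_separated C {c\<^sub>0 + t *\<^sub>R u}"
      using ssp unfolding strong_separation_property_def by simp
    then obtain g :: "'a \<Rightarrow>\<^sub>L real" and a b where g: "a < b" "\<And>c. c \<in> C \<Longrightarrow> blinfun_apply g c \<le> a"
      "b \<le> blinfun_apply g (c\<^sub>0 + t *\<^sub>R u)"
      using strongly_separatedE[of C "{c\<^sub>0 + t *\<^sub>R u}"] by (metis singletonI)
    have "((\<lambda>n. blinfun_apply g c\<^sub>0 + t * blinfun_apply g (x n))
        \<longlongrightarrow> blinfun_apply g c\<^sub>0 + t * blinfun_apply g u) U"
      by (intro tendsto_intros u)
    moreover have "\<forall>\<^sub>F n in U. blinfun_apply g c\<^sub>0 + t * blinfun_apply g (x n) \<le> a"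
      using large[of t]
    proof eventually_elim
      case (elim n)
      then have "c\<^sub>0 + t *\<^sub>R x n \<in> C"
        unfolding x_def using that by (intro convex_segment_of_ray C c\<^sub>0 d) auto
      from g(2)[OF this] show ?case by (simp add: blinfun.add_right blinfun.scaleR_right)
    qed
    ultimately have "blinfun_apply g c\<^sub>0 + t * blinfun_apply g u \<le> a"
      using tendsto_upperbound U(1) by blast
    then show False using g(1,3) by (simp add: blinfun.add_right blinfun.scaleR_right)
  qed
  ultimately show False
    using strong_separation_property_no_flat_direction[OF C ssp f] fu by blast
qed

theorem theorem9:
  fixes C :: "'a::real_normed_vector set"
  assumes "closed C" and "convex C"
    and "strong_separation_property C"
    and "(reflexive_space TYPE('a) \<and> interior (barrier_cone C) \<noteq> {})
       \<or> locally_compact_convex C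
       \<or> (\<exists>r>0. \<exists>Z. finite_dim_subspace Z \<and> C \<subseteq> ball 0 r + Z)"
  shows "barrier_cone C = interior (barrier_cone C) \<union> {0}"
proof
  show "interior (barrier_cone C) \<union> {0} \<subseteq> barrier_cone C"
    using interior_subset by (auto simp: barrier_cone_iff intro: exI[of _ 0])
  show "barrier_cone C \<subseteq> interior (barrier_cone C) \<union> {0}"
  proof (cases "C = {}")
    case True
    \<comment> \<open>For empty \<open>C\<close> every bound holds vacuously, and the whole dual is
      its own interior.\<close>
    then have "barrier_cone C = UNIV" by (auto simp: barrier_cone_iff)
    then show ?thesis by simp
  next
    case False
    then obtain c\<^sub>0 where c\<^sub>0: "c\<^sub>0 \<in> C" by blast
    have "f \<in> interior (barrier_cone C)" if "f \<in> barrier_cone C" "f \<noteq> 0" for f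
      using assms(4) barrier_cone_interior_reflexive[OF assms(1-3) _ _ that c\<^sub>0]
        barrier_cone_interior_locally_compact[OF assms(1-3) _ that]
        barrier_cone_interior_finite_dim[OF assms(1-3) _ _ that c\<^sub>0]
      by blast
    then show ?thesis by blast
  qed
qed

end
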